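(* Let $\lambda\ge 2$ and let $t=\sum_{i=0}^{\lambda-1}\tau_i$ for some positive odd integers $\tau_0,\dots,\tau_{\lambda-1}$. Let $d$ be even. Suppose that for every $i\in\{0,\dots,\lambda-1\}$ there is a good conduit $H_i$ with parameters $(\tau_i,d/2,\gamma_i,c_i)$. Then there is a graph $G$ of maximum degree $d$ such that $\chi(G^t)\ge \left(\prod_{i=0}^{\lambda-1}c_i\right)d^t/2^t$ and whose girth satisfies $\mathrm{girth}(G)\ge \min\{\lambda,8,\min_i\gamma_i\}$. Moreover, $G$ is bipartite if and only if $t$ is even.
   Context: For a positive integer $t$, $G^t$ denotes the graph on the vertex set of $G$ in which two distinct vertices are adjacent iff they are joined by a path of length at most $t$ in $G$. A balanced bipartite graph $H$ with parts $A$ and $B$, $|A|=|B|$, is a good conduit (between $A$ and $B$) with parameters $(\tau,\Delta,\gamma,c)$ (where $c>0$) if $H$ has girth $\gamma$, $H$ is regular of degree $\Delta$, for every $a\in A$ and $b\in B$ there is a path of length at most $\tau$ between $a$ and $b$ in $H$, and $|A|\ge c\Delta^\tau$. *)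

theory Defs
  imports Complex_Main "HOL-Library.Extended_Nat" "Graph_Theory.Graph_Theory"
begin

text \<open>
  Finite simple graphs are the symmetric loop-free digraphs of the locale
  \<^locale>\<open>pair_graph\<close>: each edge is a pair of opposite arcs, so the degree of a vertex
  is its \<^const>\<open>out_degree\<close>.
\<close>

definition joined_within :: "'a pair_pre_digraph \<Rightarrow> nat \<Rightarrow> 'a \<Rightarrow> 'a \<Rightarrow> bool" where
  "joined_within G k u v \<longleftrightarrow>
     (\<exists>p. vpath p (with_proj G) \<and> hd p = u \<and> last p = v \<and> vwalk_length p \<le> k)"

definition graph_power :: "'a pair_pre_digraph \<Rightarrow> nat \<Rightarrow> 'a pair_pre_digraph" where
  "graph_power G k =
     \<lparr> pverts = pverts G,
       parcs = {(u, v). u \<in> pverts G \<and> v \<in> pverts G \<and> u \<noteq> v \<and> joined_within G k u v} \<rparr>"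

text \<open>
  Lengths below 3 are excluded because the library counts traversing one edge back and forth
  as a cycle. The girth of an acyclic graph is \<open>\<infinity>\<close>.
\<close>
definition girth :: "'a pair_pre_digraph \<Rightarrow> enat" where
  "girth G = Inf {enat (length p) | p. pre_digraph.cycle (with_proj G) p \<and> 3 \<le> length p}"

definition max_degree :: "'a pair_pre_digraph \<Rightarrow> nat" where
  "max_degree G = Max (out_degree (with_proj G) ` pverts G)"

definition regular :: "'a pair_pre_digraph \<Rightarrow> nat \<Rightarrow> bool" where
  "regular G k \<longleftrightarrow> (\<forall>v \<in> pverts G. out_degree (with_proj G) v = k)"

definition proper_colouring :: "'a pair_pre_digraph \<Rightarrow> nat \<Rightarrow> ('a \<Rightarrow> nat) \<Rightarrow> bool" where
  "proper_colouring G k f \<longleftrightarrow>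
     f ` pverts G \<subseteq> {..<k} \<and> (\<forall>(u, v) \<in> parcs G. f u \<noteq> f v)"

definition chromatic_number :: "'a pair_pre_digraph \<Rightarrow> nat" where
  "chromatic_number G = (LEAST k. \<exists>f. proper_colouring G k f)"

definition bipartition :: "'a pair_pre_digraph \<Rightarrow> 'a set \<Rightarrow> 'a set \<Rightarrow> bool" where
  "bipartition G A B \<longleftrightarrow>
     A \<union> B = pverts G \<and> A \<inter> B = {} \<and> parcs G \<subseteq> A \<times> B \<union> B \<times> A"

definition bipartite :: "'a pair_pre_digraph \<Rightarrow> bool" where
  "bipartite G \<longleftrightarrow> (\<exists>A B. bipartition G A B)"

text \<open>
  \<open>A \<noteq> {}\<close> spells out the convention that graphs are nonempty. The empty graph
  would otherwise be a conduit of degree 0.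
\<close>
definition good_conduit ::
  "'a pair_pre_digraph \<Rightarrow> 'a set \<Rightarrow> 'a set \<Rightarrow> nat \<Rightarrow> nat \<Rightarrow> enat \<Rightarrow> real \<Rightarrow> bool" where
  "good_conduit H A B \<tau> \<Delta> \<gamma> c \<longleftrightarrow>
     pair_graph H \<and> bipartition H A B \<and> A \<noteq> {} \<and> card A = card B \<and>
     0 < c \<and>
     girth H = \<gamma> \<and>
     regular H \<Delta> \<and>
     (\<forall>a \<in> A. \<forall>b \<in> B. joined_within H \<tau> a b) \<and>
     c * real \<Delta> ^ \<tau> \<le> real (card A)"

end

theory Submission
  imports Defs
begin

text \<open>
  Identify the two parts of every conduit by a bijection \<open>\<beta> i\<close> and let the vertices be the pairs of a
  level \<open>i\<close> modulo \<open>lam\<close> and a point \<open>x\<close> of the product of the parts \<open>A i\<close>. Edges between level \<open>i\<close>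
  and the next change coordinate \<open>i\<close> along \<open>H i\<close>. Walking once around the ring rewrites each
  coordinate at a cost of at most \<open>\<tau> i\<close>, so level 0 is a clique in the power, and the
  walk has the parity of \<open>lam\<close>, hence of \<open>t\<close>.

  A cycle shorter than \<open>lam\<close> avoids some layer, so its levels can be cut open into an interval. If it
  meets only one layer, it is a cycle of a conduit. Otherwise, if it is shorter than 8, it visits its
  highest or its lowest level only once; the two neighbours of that visit agree in the coordinate
  changed there, because no other step changes it, and so they coincide.

  For \<open>lam = 2\<close> edges of the two layers may coincide, so the maximum degree may drop below \<open>d\<close>.
  This is repaired by adding a disjoint star.
\<close>

section \<open>Cycles, walks and cliques\<close>

lemma pair_graphI:
  assumes "finite (pverts G)"
    and "\<And>u v. (u, v) \<in> parcs G \<Longrightarrow> u \<in> pverts G \<and> (v, u) \<in> parcs G \<and> u \<noteq> v"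
  shows "pair_graph G"
proof -
  have "parcs G \<subseteq> pverts G \<times> pverts G"
    using assms(2) by auto
  then have fin: "finite (parcs G)"
    using assms(1) by (meson finite_SigmaI finite_subset)
  show ?thesis
  proof
    fix e assume "e \<in> parcs G"
    then show "fst e \<in> pverts G" "snd e \<in> pverts G" "fst e \<noteq> snd e"
      using assms(2)[of "fst e" "snd e"] assms(2)[of "snd e" "fst e"] by auto
  next
    show "symmetric (with_proj G)"
      unfolding symmetric_def using assms(2) by (auto intro: symI)
  qed (use assms(1) fin in auto)
qed

lemma pair_graphD:
  assumes "pair_graph G" "(u, v) \<in> parcs G"
  shows "u \<in> pverts G" "v \<in> pverts G" "(v, u) \<in> parcs G" "u \<noteq> v"
proof -
  interpret pair_graph G by fact
  show "u \<in> pverts G" "v \<in> pverts G" "(v, u) \<in> parcs G" "u \<noteq> v"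
    using assms(2) in_arcsD1 in_arcsD2 arcs_symmetric no_loops' by blast+
qed

lemma out_degree_with_proj: "out_degree (with_proj G) v = card (parcs G `` {v})"
proof -
  have "out_arcs (with_proj G) v = Pair v ` (parcs G `` {v})"
    by (auto simp: out_arcs_def)
  then show ?thesis
    by (simp add: out_degree_def card_image inj_on_def)
qed

text \<open>A cycle is kept as a periodic function on all of \<open>nat\<close> rather than as a
  list, so that wrap-around needs no case distinction and passing to levels or coordinates is mere
  composition. \<open>n = 2\<close> covers an edge walked back and forth and \<open>n = 0\<close>
  any infinite walk; hence the lower bounds on \<open>n\<close> later.\<close>

definition cyclic_seq :: "'a pair_pre_digraph \<Rightarrow> nat \<Rightarrow> (nat \<Rightarrow> 'a) \<Rightarrow> bool" where
  "cyclic_seq G n f \<longleftrightarrow>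
     inj_on f {..<n} \<and> (\<forall>i. f (i + n) = f i \<and> (f i, f (Suc i)) \<in> parcs G)"

lemma periodic_mod:
  assumes "\<And>i. f (i + n) = f i"
  shows "f (i mod n) = f (i::nat)"
proof -
  have "f (j + k * n) = f j" for j k
    by (induction k) (use assms in \<open>simp_all add: add.assoc[symmetric] add.commute[of n]\<close>)
  from this[of "i mod n" "i div n"] show ?thesis by simp
qed

lemma cyclic_seqD:
  assumes "cyclic_seq G n f"
  shows "inj_on f {..<n}" "f (i + n) = f i" "(f i, f (Suc i)) \<in> parcs G" "f (i mod n) = f i"
  using assms periodic_mod[of f n] by (auto simp: cyclic_seq_def)

text \<open>Separates the junction of the first two arcs from the later ones, as the induction for
  \<open>pcas_iff\<close> requires.\<close>

lemma all_nat_split: "(\<forall>i. P i) \<longleftrightarrow> P 0 \<and> (\<forall>i. P (Suc i))"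
  using not0_implies_Suc by metis

text \<open>Indexed junctions replace the recursion of \<open>pcas\<close>, so that positions modulo
  the length can be compared directly.\<close>

lemma pcas_iff:
  assumes "p \<noteq> []"
  shows "pcas u p v \<longleftrightarrow> fst (hd p) = u \<and> snd (last p) = v \<and>
    (\<forall>i. Suc i < length p \<longrightarrow> snd (p ! i) = fst (p ! Suc i))"
  using assms
proof (induction p arbitrary: u)
  case (Cons e p)
  show ?case
  proof (cases "p = []")
    case False
    then show ?thesis
      using Cons.IH[OF False, of "snd e"]
        all_nat_split[of "\<lambda>i. Suc i < length (e # p) \<longrightarrow> snd ((e # p) ! i) = fst ((e # p) ! Suc i)"]
      by (auto simp: hd_conv_nth)
  qed auto
qed auto

lemma tl_pawalk_verts:
  assumes "pcas u p v" shows "tl (pawalk_verts u p) = map snd p"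
proof -
  have "pawalk_verts u p = u # map snd p"
    using assms by (induction p arbitrary: u) auto
  then show ?thesis by simp
qed

lemma cyclic_seq_of_cycle:
  assumes "pre_digraph.cycle (with_proj G) p"
  obtains f where "cyclic_seq G (length p) f"
proof -
  let ?n = "length p"
  \<comment> \<open>The entry at \<open>i\<close> is the head of arc \<open>i\<close>, so the step
    from \<open>i\<close> to \<open>Suc i\<close> runs along arc \<open>Suc i\<close> modulo the
    length.\<close>
  let ?f = "\<lambda>i. snd (p ! (i mod ?n))"
  from assms obtain u where u: "set p \<subseteq> parcs G" "pcas u p u" "p \<noteq> []" "distinct (map snd p)"
    unfolding pre_digraph.cycle_def pre_digraph.awalk_def cas_with_proj_eq awalk_verts_with_proj_eq
    using tl_pawalk_verts by (metis with_proj_simps(2))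
  have next_eq: "snd (p ! (i mod ?n)) = fst (p ! (Suc i mod ?n))" for i
  proof (cases "Suc (i mod ?n) = ?n")
    case True
    then have "Suc i mod ?n = 0" "i mod ?n = ?n - 1" by (simp_all add: mod_Suc)
    then show ?thesis
      using u(2,3) unfolding pcas_iff[OF u(3)] by (simp add: hd_conv_nth last_conv_nth)
  next
    case False
    then have "Suc i mod ?n = Suc (i mod ?n)" "Suc (i mod ?n) < ?n"
      using u(3) by (simp_all add: mod_Suc Suc_lessI)
    then show ?thesis
      using u(2) unfolding pcas_iff[OF u(3)] by simp
  qed
  have "(?f i, ?f (Suc i)) = p ! (Suc i mod ?n)" for i
    by (subst next_eq) simp
  moreover have "p ! (Suc i mod ?n) \<in> parcs G" for i
    using u(1,3) by (auto intro!: subsetD[OF u(1)] nth_mem)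
  moreover have "inj_on ?f {..<?n}"
    using u(4) by (auto simp: inj_on_def distinct_conv_nth)
  ultimately have "cyclic_seq G ?n ?f"
    by (simp add: cyclic_seq_def)
  then show thesis by (rule that)
qed

lemma cycle_of_cyclic_seq:
  assumes "pair_graph G" "cyclic_seq G n f" "0 < n"
  shows "pre_digraph.cycle (with_proj G) (map (\<lambda>i. (f i, f (Suc i))) [0..<n])"
    (is "pre_digraph.cycle _ ?p")
proof -
  have arcs: "(f i, f (Suc i)) \<in> parcs G" for i
    using cyclic_seqD(3)[OF assms(2)] .
  have "f n = f 0"
    using cyclic_seqD(2)[OF assms(2), of 0] by simp
  then have cas: "pcas (f 0) ?p (f 0)"
    using assms(3) by (subst pcas_iff) (auto simp: hd_map last_map)
  \<comment> \<open>The cycle predicate asks for distinct heads of arcs. These are the values at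
    \<open>1\<close> to \<open>n\<close>, so injectivity has to be moved to the shifted
    period.\<close>
  have "inj_on (\<lambda>i. f (Suc i)) {..<n}"
  proof (rule inj_onI)
    fix i j assume "i \<in> {..<n}" "j \<in> {..<n}" "f (Suc i) = f (Suc j)"
    then have "Suc i mod n = Suc j mod n"
      using cyclic_seqD(1)[OF assms(2)] cyclic_seqD(4)[OF assms(2), of "Suc i"]
        cyclic_seqD(4)[OF assms(2), of "Suc j"] assms(3)
      by (metis inj_onD lessThan_iff mod_less_divisor)
    then show "i = j"
      using \<open>i \<in> {..<n}\<close> \<open>j \<in> {..<n}\<close> by (auto simp: mod_Suc split: if_splits)
  qed
  then have "distinct (map snd ?p)"
    by (auto simp: distinct_map atLeast0LessThan o_def)
  moreover have "f 0 \<in> pverts G"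
    using arcs pair_graphD(1)[OF assms(1)] by blast
  ultimately show ?thesis
    unfolding pre_digraph.cycle_def pre_digraph.awalk_def cas_with_proj_eq awalk_verts_with_proj_eq
    using cas arcs assms(3) tl_pawalk_verts[OF cas]
    by (intro exI[of _ "f 0"]) auto
qed

text \<open>Together with \<open>le_girthI\<close> this reduces girth bounds to periodic sequences;
  later girth arguments never touch arc lists.\<close>

lemma girth_le:
  assumes "pair_graph G" "cyclic_seq G n f" "3 \<le> n"
  shows "girth G \<le> enat n"
  unfolding girth_def
  by (rule Inf_lower)
     (use cycle_of_cyclic_seq[OF assms(1,2)] assms(3) in
       \<open>auto intro!: exI[of _ "map (\<lambda>i. (f i, f (Suc i))) [0..<n]"]\<close>)

lemma le_girthI:
  assumes "\<And>n f. 3 \<le> n \<Longrightarrow> cyclic_seq G n f \<Longrightarrow> g \<le> enat n"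
  shows "g \<le> girth G"
  unfolding girth_def
  by (rule Inf_greatest) (use assms cyclic_seq_of_cycle in blast)

section \<open>Walks as powers of the arc relation\<close>

lemma vwalk_of_relpow:
  assumes "pair_graph G" "u \<in> pverts G" "(u, v) \<in> parcs G ^^ m"
  shows "\<exists>p. vwalk p (with_proj G) \<and> hd p = u \<and> last p = v \<and> length p = Suc m"
  using assms(3)
proof (induction m arbitrary: v)
  case 0
  then show ?case using assms(2) by (intro exI[of _ "[u]"]) (auto intro: vwalkI)
next
  case (Suc m)
  then obtain w where wv: "(u, w) \<in> parcs G ^^ m" "(w, v) \<in> parcs G" by auto
  with Suc.IH obtain p where w: "(w, v) \<in> parcs G" "vwalk p (with_proj G)" "hd p = u" "last p = w"
      "length p = Suc m" by blast
  have "vwalk (p @ [v]) (with_proj G)"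
    using w pair_graphD(2)[OF assms(1) w(1)]
    by (auto simp: vwalk_def set_vwalk_arcs_snoc)
  then show ?case
    using w by (intro exI[of _ "p @ [v]"]) (auto simp: hd_append vwalk_def)
qed

lemma relpow_of_vwalk:
  assumes "vwalk p (with_proj G)"
  shows "(hd p, last p) \<in> parcs G ^^ vwalk_length p"
  using assms
proof (induction p rule: vwalk_induct)
  case (Cons u v es)
  then have "(u, last (v # es)) \<in> parcs G ^^ Suc (length es)"
    by (intro relpow_Suc_I2[of u v]) auto
  then show ?case by simp
qed auto

lemma length_vwalk_to_vpath_le: "length (vwalk_to_vpath p) \<le> length p"
proof (induction p rule: vwalk_to_vpath_induct3)
  case (in_set x xs)
  then show ?case
    using length_dropWhile_le[of "\<lambda>y. y \<noteq> x" xs] by simp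
qed auto

text \<open>Cutting repetitions out of a walk never lengthens it, so paths and walks of bounded
  length reach the same vertices. Relation powers concatenate and follow homomorphisms, which paths
  need not do.\<close>

lemma joined_within_iff_relpow:
  assumes "pair_graph G" "u \<in> pverts G"
  shows "joined_within G k u v \<longleftrightarrow> (\<exists>m\<le>k. (u, v) \<in> parcs G ^^ m)"
proof
  assume "joined_within G k u v"
  then obtain p where "vwalk p (with_proj G)" "hd p = u" "last p = v" "vwalk_length p \<le> k"
    by (auto simp: joined_within_def vpath_def)
  then show "\<exists>m\<le>k. (u, v) \<in> parcs G ^^ m"
    using relpow_of_vwalk by blast
next
  assume "\<exists>m\<le>k. (u, v) \<in> parcs G ^^ m"
  then obtain m p where "m \<le> k" "vwalk p (with_proj G)" "hd p = u" "last p = v" "length p = Suc m"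
    using vwalk_of_relpow[OF assms] by blast
  then show "joined_within G k u v"
    unfolding joined_within_def
    using vwalk_to_vpath_vpath[of p] length_vwalk_to_vpath_le[of p]
    by (intro exI[of _ "vwalk_to_vpath p"])
       (auto simp: vwalk_to_vpath_hd vwalk_to_vpath_last)
qed

section \<open>Homomorphisms, parity of walks, cliques\<close>

lemma relpow_hom:
  assumes "\<And>u v. (u, v) \<in> R \<Longrightarrow> (\<phi> u, \<phi> v) \<in> S"
    and "(u, v) \<in> R ^^ m"
  shows "(\<phi> u, \<phi> v) \<in> S ^^ m"
  using assms(2) by (induction m arbitrary: v) (use assms(1) in auto)

text \<open>Every step changes sides. This fixes the parity of walks across a conduit and excludes
  odd closed walks in a bipartite ring.\<close>

lemma bipartition_walk:
  assumes "bipartition G A B" "u \<in> pverts G" "(u, v) \<in> parcs G ^^ m"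
  shows "v \<in> A \<longleftrightarrow> (even m \<longleftrightarrow> u \<in> A)"
  using assms(3)
proof (induction m arbitrary: v)
  case (Suc m)
  then obtain w where "(u, w) \<in> parcs G ^^ m" "(w, v) \<in> parcs G" by auto
  then show ?case
    using Suc.IH[of w] assms(1) unfolding bipartition_def by auto
qed auto

text \<open>A proper colouring is injective on a clique.\<close>

lemma card_clique_le_chromatic_number:
  assumes "finite (pverts G)" "\<And>u. (u, u) \<notin> parcs G"
    and "S \<subseteq> pverts G" "\<And>u v. u \<in> S \<Longrightarrow> v \<in> S \<Longrightarrow> u \<noteq> v \<Longrightarrow> (u, v) \<in> parcs G"
    and arcs: "parcs G \<subseteq> pverts G \<times> pverts G"
  shows "card S \<le> chromatic_number G"
proof -
  \<comment> \<open>A numbering of the vertices is a proper colouring, as there are no loops; hence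
    the \<open>LEAST\<close> in \<open>chromatic_number\<close> is attained.\<close>
  obtain f where "bij_betw f (pverts G) {..<card (pverts G)}"
    using ex_bij_betw_finite_nat[OF assms(1)] by (auto simp: atLeast0LessThan)
  then have "proper_colouring G (card (pverts G)) f"
    using arcs assms(2) unfolding proper_colouring_def bij_betw_def inj_on_def by fastforce
  then obtain f where f: "proper_colouring G (chromatic_number G) f"
    unfolding chromatic_number_def using LeastI_ex[of "\<lambda>k. \<exists>f. proper_colouring G k f"] by blast
  then have "inj_on f S"
    using assms(4) unfolding proper_colouring_def by (fastforce intro: inj_onI)
  moreover have "f ` S \<subseteq> {..<chromatic_number G}"
    using f assms(3) unfolding proper_colouring_def by blast
  ultimately show ?thesis
    using card_inj_on_le[of f S "{..<chromatic_number G}"] by simp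
qed

section \<open>Closed sequences of levels\<close>

text \<open>Here \<open>h i\<close> is a level, \<open>X i\<close> a point and \<open>s i\<close>
  the layer, hence the coordinate, of step \<open>i\<close>. The first and the last step both use
  the layer just below the peak, and every other step stays too low for it. So coordinate
  \<open>s 0\<close> rests between the two neighbours of the peak, while the other coordinates rest
  during the two steps at the peak.\<close>

lemma unique_extremum_collapses:
  fixes h :: "nat \<Rightarrow> int" and s :: "nat \<Rightarrow> 'k" and X :: "nat \<Rightarrow> 'k \<Rightarrow> 'b"
  assumes "3 \<le> n" "h n = h 0" "X n = X 0"
    and step: "\<And>i. \<bar>h (Suc i) - h i\<bar> = 1"
    and coord: "\<And>i k. k \<noteq> s i \<Longrightarrow> X (Suc i) k = X i k"
    and layer: "\<And>i j. s i = s j \<longleftrightarrow> h i + h (Suc i) = h j + h (Suc j)"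
    and peak: "\<And>i. 0 < i \<Longrightarrow> i < n \<Longrightarrow> h i < h 0"
  shows "h 1 = h (n - 1)" "X 1 = X (n - 1)"
proof -
  have n: "Suc (n - 1) = n" using assms(1) by simp
  have h1: "h 1 = h 0 - 1"
    using step[of 0] peak[of 1] assms(1) by simp
  moreover have hn: "h (n - 1) = h 0 - 1"
    using step[of "n - 1"] peak[of "n - 1"] assms(1,2) n by simp
  ultimately show "h 1 = h (n - 1)" by simp
  show "X 1 = X (n - 1)"
  proof
    fix k
    show "X 1 k = X (n - 1) k"
    proof (cases "k = s 0")
      case True
      have "X (Suc i) k = X 1 k" if "Suc i < n" for i
        using that
      proof (induction i)
        case (Suc i)
        \<comment> \<open>Both ends lie strictly below the peak, so the sum is at most
          \<open>2 * h 0 - 2\<close>, whereas step \<open>0\<close> has sum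
          \<open>2 * h 0 - 1\<close>.\<close>
        then have "h (Suc i) + h (Suc (Suc i)) \<noteq> h 0 + h (Suc 0)"
          using peak[of "Suc i"] peak[of "Suc (Suc i)"] h1 by simp
        then have "k \<noteq> s (Suc i)"
          using True layer[of "Suc i" 0] by auto
        then show ?case using Suc coord by simp
      qed simp
      from this[of "n - 2"] show ?thesis
        using assms(1) by (simp add: numeral_2_eq_2 Suc_diff_Suc)
    next
      case False
      have "s (n - 1) = s 0"
        using layer[of "n - 1" 0] h1 hn n assms(2) by simp
      then have "X (n - 1) k = X n k"
        using coord[of k "n - 1"] False n by simp
      then show ?thesis using coord[of k 0] False assms(3) by simp
    qed
  qed
qed

text \<open>
  Each vertex on an extreme level accounts for two steps of its own, so in a sequence of length
  less than 8 the top or the bottom level is visited only once.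
\<close>
lemma unique_extremum:
  fixes h :: "nat \<Rightarrow> int"
  assumes "0 < n" "n < 8"
    and per: "\<And>i. h (i + n) = h i"
    and step: "\<And>i. \<bar>h (Suc i) - h i\<bar> = 1"
    and "h i + h (Suc i) \<noteq> h j + h (Suc j)"
  obtains p where "p < n" "(\<forall>i<n. i \<noteq> p \<longrightarrow> h i < h p) \<or> (\<forall>i<n. i \<noteq> p \<longrightarrow> h p < h i)"
proof -
  define M where "M = Max (h ` {..<n})"
  define m where "m = Min (h ` {..<n})"
  have bound: "m \<le> h i" "h i \<le> M" for i
    using periodic_mod[of h n i, OF per] assms(1)
    by (metis M_def m_def Max_ge Min_le finite_imageI finite_lessThan imageI lessThan_iff mod_less_divisor)+
  \<comment> \<open>With only two adjacent levels all steps would have the same level sum, against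
    the last assumption.\<close>
  have "m + 2 \<le> M"
  proof (rule ccontr)
    assume "\<not> m + 2 \<le> M"
    then have "h i + h (Suc i) = m + M" for i
      using step[of i] bound[of i] bound[of "Suc i"] by linarith
    with assms(5) show False by simp
  qed
  define lev where "lev x = {i\<in>{..<n}. h i = x}" for x
  define bef where "bef x = {i\<in>{..<n}. h (Suc i) = x}" for x
  have card_le: "card (lev x) \<le> card (bef x)" for x
  proof (rule card_inj_on_le)
    \<comment> \<open>The cyclic predecessor turns an index on level \<open>x\<close> into one whose
      successor is on level \<open>x\<close>.\<close>
    let ?g = "\<lambda>i. if i = 0 then n - 1 else i - 1"
    show "inj_on ?g (lev x)" by (auto simp: inj_on_def lev_def split: if_splits)
    show "?g ` lev x \<subseteq> bef x"
      using assms(1) per[of 0] by (auto simp: lev_def bef_def)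
  qed (simp add: bef_def)
  have fin: "finite (lev x)" "finite (bef x)" for x by (simp_all add: lev_def bef_def)
  have "\<not> (h i = x \<and> h (Suc i) = x)" "\<not> (h i = M \<and> h (Suc i) = m)"
      "\<not> (h i = m \<and> h (Suc i) = M)" for i x
    using step[of i] \<open>m + 2 \<le> M\<close> by auto
  moreover have "M \<noteq> m" using \<open>m + 2 \<le> M\<close> by simp
  ultimately have disj: "lev M \<inter> bef M = {}" "lev m \<inter> bef m = {}"
      "(lev M \<union> bef M) \<inter> (lev m \<union> bef m) = {}"
    unfolding lev_def bef_def by blast+
  have "card (lev M) + card (bef M) + (card (lev m) + card (bef m))
      = card (lev M \<union> bef M \<union> (lev m \<union> bef m))"
    using disj fin by (simp add: card_Un_disjoint)
  also have "\<dots> \<le> card {..<n}"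
    by (rule card_mono) (auto simp: lev_def bef_def)
  \<comment> \<open>Two visits to both extremes would make the four disjoint sets occupy at least 8
    indices.\<close>
  finally have "card (lev M) \<le> 1 \<or> card (lev m) \<le> 1"
    using card_le[of M] card_le[of m] assms(2) unfolding card_lessThan by linarith
  moreover have "M \<in> h ` {..<n}" "m \<in> h ` {..<n}"
    unfolding M_def m_def using assms(1) by (auto intro!: Max_in Min_in)
  ultimately obtain p x where p: "p \<in> lev x" "card (lev x) \<le> 1" "x = M \<or> x = m"
    unfolding lev_def by auto
  have "i = p" if "i < n" "h i = x" for i
  proof -
    have "i \<in> lev x" using that by (simp add: lev_def)
    then show ?thesis using p(1,2) fin(1)[of x] card_le_Suc0_iff_eq[of "lev x"] by simp
  qed
  moreover have "h p = x" using p(1) by (simp add: lev_def)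
  ultimately have ne: "h i \<noteq> h p" if "i < n" "i \<noteq> p" for i using that by blast
  have "(\<forall>i<n. i \<noteq> p \<longrightarrow> h i < h p) \<or> (\<forall>i<n. i \<noteq> p \<longrightarrow> h p < h i)"
    using p(3)
  proof
    assume "x = M"
    then have "h i < h p" if "i < n" "i \<noteq> p" for i
      using ne[OF that] bound(2)[of i] \<open>h p = x\<close> by simp
    then show ?thesis by blast
  next
    assume "x = m"
    then have "h p < h i" if "i < n" "i \<noteq> p" for i
      using ne[OF that] bound(1)[of i] \<open>h p = x\<close> by simp
    then show ?thesis by blast
  qed
  then show thesis using p(1) that by (auto simp: lev_def)
qed

text \<open>A rotation moves the unique extremum to index 0, and negating the levels turns a minimum
  into a maximum without affecting the criterion for equal layers.\<close>

lemma short_multilayer_collapses: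
  fixes h :: "nat \<Rightarrow> int" and s :: "nat \<Rightarrow> 'k" and X :: "nat \<Rightarrow> 'k \<Rightarrow> 'b"
  assumes "3 \<le> n" "n < 8"
    and per: "\<And>i. h (i + n) = h i" "\<And>i. X (i + n) = X i"
    and step: "\<And>i. \<bar>h (Suc i) - h i\<bar> = 1"
    and coord: "\<And>i k. k \<noteq> s i \<Longrightarrow> X (Suc i) k = X i k"
    and layer: "\<And>i j. s i = s j \<longleftrightarrow> h i + h (Suc i) = h j + h (Suc j)"
    and "s i0 \<noteq> s j0"
  obtains i j where "i < n" "j < n" "i \<noteq> j" "h i = h j" "X i = X j"
proof -
  obtain p where p: "p < n" "(\<forall>i<n. i \<noteq> p \<longrightarrow> h i < h p) \<or> (\<forall>i<n. i \<noteq> p \<longrightarrow> h p < h i)"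
    using unique_extremum[of n h i0 j0] assms by auto
  have per': "h (i mod n) = h i" "X (i mod n) = X i" for i
    using periodic_mod[of h n] periodic_mod[of X n] per by auto
  have other: "(p + i) mod n < n \<and> (p + i) mod n \<noteq> p" if "0 < i" "i < n" for i
    using that p(1) by (auto simp: mod_if)
  have rot: "h (p + n) = h (p + 0)" "X (p + n) = X (p + 0)"
      "\<And>i. \<bar>h (p + Suc i) - h (p + i)\<bar> = 1"
      "\<And>i k. k \<noteq> s (p + i) \<Longrightarrow> X (p + Suc i) k = X (p + i) k"
      "\<And>i j. s (p + i) = s (p + j) \<longleftrightarrow> h (p + i) + h (p + Suc i) = h (p + j) + h (p + Suc j)"
    using per step coord layer by simp_all
  have neg: "- h (p + n) = - h (p + 0)" "\<And>i. \<bar>- h (p + Suc i) - - h (p + i)\<bar> = 1"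
      "\<And>i j. s (p + i) = s (p + j) \<longleftrightarrow>
         - h (p + i) + - h (p + Suc i) = - h (p + j) + - h (p + Suc j)"
  proof -
    show "- h (p + n) = - h (p + 0)" using rot(1) by simp
    show "\<bar>- h (p + Suc i) - - h (p + i)\<bar> = 1" for i using rot(3)[of i] by linarith
    show "s (p + i) = s (p + j) \<longleftrightarrow>
        - h (p + i) + - h (p + Suc i) = - h (p + j) + - h (p + Suc j)" for i j
      unfolding rot(5)[of i j] by linarith
  qed
  have "h (p + 1) = h (p + (n - 1)) \<and> X (p + 1) = X (p + (n - 1))"
    using p(2)
  proof
    assume *: "\<forall>i<n. i \<noteq> p \<longrightarrow> h i < h p"
    have peak: "h (p + i) < h (p + 0)" if "0 < i" "i < n" for i
      using other[OF that] *[rule_format, of "(p + i) mod n"] per'(1)[of "p + i"] by simp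
    from unique_extremum_collapses[where h = "\<lambda>i. h (p + i)" and X = "\<lambda>i. X (p + i)"
        and s = "\<lambda>i. s (p + i)", OF assms(1) rot peak]
    show ?thesis by blast
  next
    assume *: "\<forall>i<n. i \<noteq> p \<longrightarrow> h p < h i"
    have peak: "- h (p + i) < - h (p + 0)" if "0 < i" "i < n" for i
      using other[OF that] *[rule_format, of "(p + i) mod n"] per'(1)[of "p + i"] by simp
    from unique_extremum_collapses[where h = "\<lambda>i. - h (p + i)" and X = "\<lambda>i. X (p + i)"
        and s = "\<lambda>i. s (p + i)", OF assms(1) neg(1) rot(2) neg(2) rot(4) neg(3) peak]
    show ?thesis by simp
  qed
  \<comment> \<open>The two neighbours of \<open>p\<close> are different positions because
    \<open>n\<close> is at least 3.\<close>
  moreover have "(p + 1) mod n \<noteq> (p + (n - 1)) mod n"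
    using p(1) assms(1) by (auto simp: mod_if)
  ultimately show thesis
    using that[of "(p + 1) mod n" "(p + (n - 1)) mod n"] per' assms(1) by simp
qed

section \<open>Adding a star\<close>

text \<open>\<open>0\<close> is the centre and \<open>1\<close> to \<open>d\<close> are the leaves.
  The relabelling \<open>\<phi>\<close> is meant to take values above \<open>d\<close>, which makes
  the union disjoint; for \<open>d = 0\<close> the star is a single vertex.\<close>

definition with_star :: "nat \<Rightarrow> ('v \<Rightarrow> nat) \<Rightarrow> 'v pair_pre_digraph \<Rightarrow> nat pair_pre_digraph" where
  "with_star d \<phi> G =
     \<lparr> pverts = {..d} \<union> \<phi> ` pverts G,
       parcs = {0} \<times> {1..d} \<union> {1..d} \<times> {0} \<union> map_prod \<phi> \<phi> ` parcs G \<rparr>"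

locale star_completion =
  fixes d :: nat and \<phi> :: "'v \<Rightarrow> nat" and G :: "'v pair_pre_digraph"
  assumes graph: "pair_graph G"
    and inj: "inj_on \<phi> (pverts G)"
    and above: "\<And>v. v \<in> pverts G \<Longrightarrow> d < \<phi> v"
    and degree: "\<And>v. v \<in> pverts G \<Longrightarrow> card (parcs G `` {v}) \<le> d"
begin

abbreviation "G' \<equiv> with_star d \<phi> G"

lemma arc_image: "(u, v) \<in> parcs G \<Longrightarrow> (\<phi> u, \<phi> v) \<in> parcs G'"
  by (force simp: with_star_def)

lemma arc_cases:
  assumes "(x, y) \<in> parcs G'"
  obtains (out) "x = 0" "y \<in> {1..d}"
    | ("in") "x \<in> {1..d}" "y = 0"
    | (image) u v where "x = \<phi> u" "y = \<phi> v" "(u, v) \<in> parcs G" "u \<in> pverts G" "v \<in> pverts G"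
        "d < \<phi> u" "d < \<phi> v"
  using assms pair_graphD(1,2)[OF graph] above by (auto simp: with_star_def)

lemma pair_graph_with_star: "pair_graph G'"
proof (rule pair_graphI)
  interpret pair_graph G by (rule graph)
  show "finite (pverts G')"
    using pair_finite_verts by (simp add: with_star_def)
next
  fix x y assume "(x, y) \<in> parcs G'"
  then show "x \<in> pverts G' \<and> (y, x) \<in> parcs G' \<and> x \<noteq> y"
  proof (cases rule: arc_cases)
    case (image u v)
    then show ?thesis
      using pair_graphD[OF graph image(3)] arc_image[of v u] inj
      by (auto simp: with_star_def inj_on_eq_iff)
  qed (auto simp: with_star_def)
qed

text \<open>The centre of the star attains \<open>d\<close>; the leaves and the copy of
  \<open>G\<close> stay within it.\<close>

lemma max_degree_with_star: "max_degree G' = d"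
proof -
  interpret G: pair_graph G by (rule graph)
  interpret G': pair_graph G' by (rule pair_graph_with_star)
  have deg_0: "parcs G' `` {0} = {1..d}"
  proof
    show "parcs G' `` {0} \<subseteq> {1..d}" by (auto elim!: arc_cases)
  qed (auto simp: with_star_def)
  have "card (parcs G' `` {x}) \<le> d" if x: "x \<in> pverts G'" for x
  proof (cases "x \<le> d")
    case True
    show ?thesis
    proof (cases "x = 0")
      case False
      with True have "parcs G' `` {x} \<subseteq> {0}"
        by (auto elim!: arc_cases)
      then have "card (parcs G' `` {x}) \<le> 1"
        using card_mono[of "{0::nat}" "parcs G' `` {x}"] by simp
      with True False show ?thesis by simp
    qed (simp add: deg_0)
  next
    case False
    then obtain v where v: "x = \<phi> v" "v \<in> pverts G"
      using x by (auto simp: with_star_def)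
    have "parcs G' `` {x} \<subseteq> \<phi> ` (parcs G `` {v})"
    proof
      fix y assume "y \<in> parcs G' `` {x}"
      then have "(x, y) \<in> parcs G'" by simp
      then show "y \<in> \<phi> ` (parcs G `` {v})"
        by (cases rule: arc_cases) (use v False inj in \<open>auto simp: inj_on_eq_iff\<close>)
    qed
    moreover have "finite (parcs G `` {v})"
      using G.pair_finite_arcs by (rule finite_Image)
    ultimately have "card (parcs G' `` {x}) \<le> card (parcs G `` {v})"
      by (meson card_image_le card_mono finite_imageI le_trans)
    then show ?thesis using degree[OF v(2)] by simp
  qed
  moreover have "0 \<in> pverts G'" by (simp add: with_star_def)
  then have "d \<in> (\<lambda>x. card (parcs G' `` {x})) ` pverts G'"
    by (rule rev_image_eqI) (simp add: deg_0)
  ultimately show ?thesis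
    unfolding max_degree_def out_degree_with_proj
    by (intro Max_eqI) (use G'.pair_finite_verts in auto)
qed

text \<open>A leaf has only the centre as neighbour, so a sequence that meets the star reaches the
  centre and is back there two steps later, which forces \<open>n\<close> to divide 2.\<close>

lemma star_no_cycle:
  assumes "cyclic_seq G' n f" "3 \<le> n" shows "d < f i"
proof (rule ccontr)
  note arc = cyclic_seqD(3)[OF assms(1)]
  assume "\<not> d < f i"
  have "\<exists>j. f j = 0"
  proof (cases "f i = 0")
    case False
    then have "f (Suc i) = 0"
      using arc[of i] \<open>\<not> d < f i\<close> by (auto elim!: arc_cases)
    then show ?thesis by blast
  qed blast
  then obtain j where "f j = 0" by blast
  then have "f (Suc j) \<in> {1..d}"
    using arc[of j] by (auto elim!: arc_cases)
  then have "f (Suc (Suc j)) = 0"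
    using arc[of "Suc j"] by (auto elim!: arc_cases)
  then have "f (j mod n) = f (Suc (Suc j) mod n)"
    using \<open>f j = 0\<close> cyclic_seqD(4)[OF assms(1)] by simp
  then have "j mod n = Suc (Suc j) mod n"
    using cyclic_seqD(1)[OF assms(1)] assms(2) by (auto simp: inj_on_eq_iff)
  then have "n dvd Suc (Suc j) - j"
    by (metis mod_eq_dvd_iff_nat le_SucI le_refl)
  then show False using assms(2) by (auto dest: dvd_imp_le)
qed

text \<open>Cycles avoid the star and can therefore be pulled back along
  \<open>\<phi>\<close>.\<close>

lemma girth_with_star: "girth G \<le> girth G'"
proof (rule le_girthI)
  fix n f assume n: "3 \<le> n" and f: "cyclic_seq G' n f"
  let ?g = "\<lambda>i. inv_into (pverts G) \<phi> (f i)"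
  have arc: "(?g i, ?g (Suc i)) \<in> parcs G \<and> f i \<in> \<phi> ` pverts G" for i
    using cyclic_seqD(3)[OF f, of i]
    by (cases rule: arc_cases) (use star_no_cycle[OF f n, of i] inj in auto)
  have "inj_on ?g {..<n}"
    using comp_inj_on[OF cyclic_seqD(1)[OF f] inj_on_inv_into[of _ \<phi> "pverts G"]] arc
    by (auto simp: o_def)
  then have "cyclic_seq G n ?g"
    using arc cyclic_seqD(2)[OF f] by (simp add: cyclic_seq_def)
  then show "girth G \<le> enat n" using girth_le[OF graph] n by blast
qed

lemma bipartite_with_star: "bipartite G' \<longleftrightarrow> bipartite G"
proof
  assume "bipartite G'"
  then obtain A B where "bipartition G' A B" by (auto simp: bipartite_def)
  let ?A = "{v \<in> pverts G. \<phi> v \<in> A}" and ?B = "{v \<in> pverts G. \<phi> v \<in> B}"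
  have "bipartition G ?A ?B"
    unfolding bipartition_def
  proof (intro conjI)
    show "parcs G \<subseteq> ?A \<times> ?B \<union> ?B \<times> ?A"
    proof (rule subrelI)
      fix u v assume "(u, v) \<in> parcs G"
      then show "(u, v) \<in> ?A \<times> ?B \<union> ?B \<times> ?A"
        using pair_graphD(1,2)[OF graph, of u v] arc_image[of u v] \<open>bipartition G' A B\<close>
        unfolding bipartition_def by auto
    qed
  qed (use \<open>bipartition G' A B\<close> in \<open>auto simp: bipartition_def with_star_def\<close>)
  then show "bipartite G" by (auto simp: bipartite_def)
next
  assume "bipartite G"
  then obtain A B where AB: "bipartition G A B" by (auto simp: bipartite_def)
  then have verts: "A \<union> B = pverts G" "A \<inter> B = {}" by (auto simp: bipartition_def)
  have "bipartition G' (insert 0 (\<phi> ` A)) ({1..d} \<union> \<phi> ` B)"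
    unfolding bipartition_def
  proof (intro conjI)
    show "insert 0 (\<phi> ` A) \<union> ({1..d} \<union> \<phi> ` B) = pverts G'"
      using verts by (force simp: with_star_def)
    show "insert 0 (\<phi> ` A) \<inter> ({1..d} \<union> \<phi> ` B) = {}"
    proof -
      have "\<phi> ` A \<inter> \<phi> ` B = {}"
        using verts inj_on_image_Int[OF inj, of A B] by auto
      moreover have "d < x" if "x \<in> \<phi> ` A \<or> x \<in> \<phi> ` B" for x
        using that verts above by auto
      ultimately show ?thesis by fastforce
    qed
    show "parcs G' \<subseteq> insert 0 (\<phi> ` A) \<times> ({1..d} \<union> \<phi> ` B) \<union> ({1..d} \<union> \<phi> ` B) \<times> insert 0 (\<phi> ` A)"
      using AB unfolding bipartition_def by (auto simp: with_star_def)
  qed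
  then show "bipartite G'" by (auto simp: bipartite_def)
qed

text \<open>\<open>\<phi>\<close> carries walks to walks, so the image of \<open>S\<close> is a
  clique in the power.\<close>

lemma chromatic_number_power_with_star:
  assumes "S \<subseteq> pverts G" "\<And>u v. u \<in> S \<Longrightarrow> v \<in> S \<Longrightarrow> \<exists>m\<le>t. (u, v) \<in> parcs G ^^ m"
  shows "card S \<le> chromatic_number (graph_power G' t)"
proof -
  interpret G': pair_graph G' by (rule pair_graph_with_star)
  have "(\<phi> u, \<phi> v) \<in> parcs (graph_power G' t)"
    if uv: "u \<in> S" "v \<in> S" "\<phi> u \<noteq> \<phi> v" for u v
  proof -
    have "\<phi> u \<in> pverts G'" "\<phi> v \<in> pverts G'"
      using uv assms(1) by (auto simp: with_star_def)
    moreover obtain m where "m \<le> t" "(\<phi> u, \<phi> v) \<in> parcs G' ^^ m"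
      using relpow_hom[of "parcs G" \<phi> "parcs G'"] arc_image assms(2)[OF uv(1,2)] by blast
    ultimately show ?thesis
      using uv(3) joined_within_iff_relpow[OF pair_graph_with_star, of "\<phi> u"]
      by (auto simp: graph_power_def)
  qed
  then have "card (\<phi> ` S) \<le> chromatic_number (graph_power G' t)"
    using assms(1) G'.pair_finite_verts
    by (intro card_clique_le_chromatic_number) (auto simp: graph_power_def with_star_def)
  then show ?thesis
    using assms(1) inj by (metis card_image inj_on_subset)
qed

end

section \<open>The ring of conduits\<close>

locale conduit_ring =
  fixes lam :: nat and H :: "nat \<Rightarrow> 'a pair_pre_digraph"
    and A B :: "nat \<Rightarrow> 'a set" and \<beta> :: "nat \<Rightarrow> 'a \<Rightarrow> 'a"
  assumes lam: "2 \<le> lam"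
    and graph: "i < lam \<Longrightarrow> pair_graph (H i)"
    and parts: "i < lam \<Longrightarrow> bipartition (H i) (A i) (B i)"
    and bij: "i < lam \<Longrightarrow> bij_betw (\<beta> i) (A i) (B i)"
begin

text \<open>The extensional product fixes all values outside \<open>{..<lam}\<close>; this keeps the
  set finite and makes its size the product of the sizes of the \<open>A i\<close>.\<close>

definition points :: "(nat \<Rightarrow> 'a) set" where
  "points = Pi\<^sub>E {..<lam} A"

text \<open>
  The copies of \<open>H i\<close> run between level \<open>i\<close>, where coordinate \<open>i\<close> is read as a vertex of \<open>A i\<close>,
  and the next level, where it is read as a vertex of \<open>B i\<close> by means of \<open>\<beta> i\<close>.
\<close>
definition up :: "nat \<times> (nat \<Rightarrow> 'a) \<Rightarrow> nat \<times> (nat \<Rightarrow> 'a) \<Rightarrow> bool" where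
  "up u v \<longleftrightarrow> fst u < lam \<and> fst v = Suc (fst u) mod lam \<and> snd u \<in> points \<and> snd v \<in> points \<and>
     (\<forall>k. k \<noteq> fst u \<longrightarrow> snd v k = snd u k) \<and>
     (snd u (fst u), \<beta> (fst u) (snd v (fst u))) \<in> parcs (H (fst u))"

definition ring :: "(nat \<times> (nat \<Rightarrow> 'a)) pair_pre_digraph" where
  "ring = \<lparr> pverts = {..<lam} \<times> points, parcs = {(u, v). up u v \<or> up v u} \<rparr>"

lemma up_arc: "up u v \<Longrightarrow> (u, v) \<in> parcs ring" "up u v \<Longrightarrow> (v, u) \<in> parcs ring"
  by (auto simp: ring_def)

lemma finite_A: "i < lam \<Longrightarrow> finite (A i)"
proof -
  assume "i < lam"
  interpret pair_graph "H i" by (rule graph) fact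
  show ?thesis
    using parts[OF \<open>i < lam\<close>] pair_finite_verts by (auto simp: bipartition_def intro: finite_subset)
qed

lemma finite_points: "finite points"
  unfolding points_def by (rule finite_PiE) (use finite_A in auto)

lemma card_points: "card points = (\<Prod>i<lam. card (A i))"
  unfolding points_def by (simp add: card_PiE)

lemma points_A: "x \<in> points \<Longrightarrow> i < lam \<Longrightarrow> x i \<in> A i"
  by (auto simp: points_def)

lemma points_update: "x \<in> points \<Longrightarrow> i < lam \<Longrightarrow> a \<in> A i \<Longrightarrow> x(i := a) \<in> points"
  by (auto simp: points_def PiE_def extensional_def)

lemma Suc_mod_lam_neq: "i < lam \<Longrightarrow> Suc i mod lam \<noteq> i"
  using lam by (auto simp: mod_Suc)

lemma Suc_mod_lam_inj: "i < lam \<Longrightarrow> j < lam \<Longrightarrow> Suc i mod lam = Suc j mod lam \<Longrightarrow> i = j"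
  by (auto simp: mod_Suc split: if_splits)

lemma pair_graph_ring: "pair_graph ring"
proof (rule pair_graphI)
  show "finite (pverts ring)" using finite_points by (simp add: ring_def)
next
  have *: "u \<in> pverts ring \<and> v \<in> pverts ring \<and> u \<noteq> v" if "up u v" for u v
  proof -
    have "fst u < lam" "fst v = Suc (fst u) mod lam" "snd u \<in> points" "snd v \<in> points"
      using that by (simp_all add: up_def)
    then show ?thesis
      using Suc_mod_lam_neq[of "fst u"] lam by (auto simp: ring_def mem_Times_iff)
  qed
  show "u \<in> pverts ring \<and> (v, u) \<in> parcs ring \<and> u \<noteq> v" if "(u, v) \<in> parcs ring" for u v
  proof -
    have "up u v \<or> up v u" using that by (simp add: ring_def)
    then show ?thesis using * up_arc by blast
  qed
qed

text \<open>Neighbours one level up and one level down each inject into a neighbourhood in one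
  conduit, since only one coordinate changes. Only a bound results, because for
  \<open>lam = 2\<close> the two sets may overlap.\<close>

lemma degree_ring:
  assumes "\<And>i. i < lam \<Longrightarrow> regular (H i) \<Delta>" and u: "u \<in> pverts ring"
  shows "card (parcs ring `` {u}) \<le> 2 * \<Delta>"
proof -
  obtain i x where ix: "u = (i, x)" "i < lam" "x \<in> points"
    using u by (auto simp: ring_def)
  have deg: "card (parcs (H j) `` {a}) = \<Delta>" "finite (parcs (H j) `` {a})"
    if "j < lam" "a \<in> A j \<union> B j" for j a
  proof -
    interpret pair_graph "H j" by (rule graph) fact
    show "card (parcs (H j) `` {a}) = \<Delta>"
      using assms(1)[OF that(1)] parts[OF that(1)] that(2)
      by (auto simp: regular_def out_degree_with_proj bipartition_def)
    show "finite (parcs (H j) `` {a})" using pair_finite_arcs by (rule finite_Image)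
  qed
  have ups: "card {v. up u v} \<le> \<Delta>" "finite {v. up u v}"
  proof -
    let ?g = "\<lambda>v. \<beta> i (snd v i)"
    have inj: "inj_on ?g {v. up u v}"
    proof (rule inj_onI)
      fix v w assume v: "v \<in> {v. up u v}" and w: "w \<in> {v. up u v}" and "?g v = ?g w"
      then have "snd v i = snd w i"
        using bij[OF ix(2)] points_A[of "snd v" i] points_A[of "snd w" i] ix
        by (auto simp: up_def bij_betw_def inj_on_def)
      then have "snd v = snd w"
        using v w ix by (fastforce simp: up_def)
      then show "v = w" using v w by (auto simp: up_def prod_eq_iff)
    qed
    have sub: "?g ` {v. up u v} \<subseteq> parcs (H i) `` {x i}"
      using ix by (auto simp: up_def)
    note d = deg[OF ix(2), of "x i"]
    show "card {v. up u v} \<le> \<Delta>"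
      using card_inj_on_le[OF inj sub] d points_A[OF ix(3,2)] by simp
    show "finite {v. up u v}"
      using finite_imageD[OF finite_subset[OF sub] inj] d points_A[OF ix(3,2)] by simp
  qed
  have downs: "card {v. up v u} \<le> \<Delta>" "finite {v. up v u}"
  proof -
    \<comment> \<open>\<open>j\<close> is the level cyclically before \<open>i\<close>; all lower
      neighbours of \<open>u\<close> lie there.\<close>
    obtain j where j: "j < lam" "Suc j mod lam = i"
    proof (cases "i = 0")
      case True then show thesis using lam that[of "lam - 1"] by simp
    next
      case False then show thesis using ix(2) that[of "i - 1"] by simp
    qed
    have fst_eq: "fst v = j" if "up v u" for v
    proof (rule Suc_mod_lam_inj)
      show "fst v < lam" "Suc (fst v) mod lam = Suc j mod lam"
        using that j(2) ix(1) by (simp_all add: up_def)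
    qed (rule j(1))
    let ?g = "\<lambda>v. snd v j"
    have inj: "inj_on ?g {v. up v u}"
    proof (rule inj_onI)
      fix v w assume v: "v \<in> {v. up v u}" and w: "w \<in> {v. up v u}" and "?g v = ?g w"
      then have "snd v j = snd w j" by simp
      moreover have "snd u k = snd v k" "snd u k = snd w k" if "k \<noteq> j" for k
        using v w that fst_eq unfolding up_def by blast+
      ultimately have "snd v = snd w" by (metis ext)
      then show "v = w" using v w fst_eq by (auto simp: prod_eq_iff)
    qed
    have sub: "?g ` {v. up v u} \<subseteq> parcs (H j) `` {\<beta> j (x j)}"
    proof (rule image_subsetI)
      fix v assume "v \<in> {v. up v u}"
      then have "up v u" by simp
      then have "(snd v j, \<beta> j (x j)) \<in> parcs (H j)"
        unfolding up_def fst_eq[OF \<open>up v u\<close>] ix(1) by simp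
      then show "snd v j \<in> parcs (H j) `` {\<beta> j (x j)}"
        using pair_graphD(3)[OF graph[OF j(1)]] by simp
    qed
    have "\<beta> j (x j) \<in> B j"
      using bij[OF j(1)] points_A[OF ix(3) j(1)] by (auto simp: bij_betw_def)
    then have d: "card (parcs (H j) `` {\<beta> j (x j)}) = \<Delta>" "finite (parcs (H j) `` {\<beta> j (x j)})"
      using deg[OF j(1)] by auto
    show "card {v. up v u} \<le> \<Delta>"
      using card_inj_on_le[OF inj sub] d by simp
    show "finite {v. up v u}"
      using finite_imageD[OF finite_subset[OF sub] inj] d by simp
  qed
  have "parcs ring `` {u} = {v. up u v} \<union> {v. up v u}"
    by (auto simp: ring_def)
  then show ?thesis
    using card_Un_le[of "{v. up u v}" "{v. up v u}"] ups downs by simp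
qed

text \<open>A walk in \<open>H i\<close> is copied into the ring with all other coordinates frozen.
  It is odd because it leads from \<open>A i\<close> to \<open>B i\<close>.\<close>

lemma layer_walk:
  assumes "i < lam" "x \<in> points" "a \<in> A i" "joined_within (H i) k (x i) (\<beta> i a)"
  shows "\<exists>m\<le>k. odd m \<and> ((i, x), (Suc i mod lam, x(i := a))) \<in> parcs ring ^^ m"
proof -
  note G = graph[OF assms(1)] and AB = parts[OF assms(1)] and b = bij[OF assms(1)]
  have xi: "x i \<in> A i" using points_A assms by blast
  then have "x i \<in> pverts (H i)" using AB by (auto simp: bipartition_def)
  then obtain m where m: "m \<le> k" "(x i, \<beta> i a) \<in> parcs (H i) ^^ m"
    using assms(4) joined_within_iff_relpow[OF G] by blast
  have "\<beta> i a \<in> B i" using b assms(3) by (auto simp: bij_betw_def)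
  then have "\<beta> i a \<notin> A i" using AB by (auto simp: bipartition_def)
  then have "odd m"
    using bipartition_walk[OF AB \<open>x i \<in> pverts (H i)\<close> m(2)] xi by simp
  \<comment> \<open>\<open>\<psi>\<close> embeds \<open>H i\<close> as its copy through
    \<open>x\<close>: the \<open>A\<close> side goes to level \<open>i\<close>, the \<open>B\<close>
    side to the next level, with \<open>\<beta> i\<close> undone.\<close>
  define \<psi> where "\<psi> c = (if c \<in> A i then (i, x(i := c))
    else (Suc i mod lam, x(i := inv_into (A i) (\<beta> i) c)))" for c
  have up: "up (\<psi> c) (\<psi> e)" if "(c, e) \<in> parcs (H i)" "c \<in> A i" "e \<in> B i" for c e
  proof -
    have "e \<notin> A i" using that AB by (auto simp: bipartition_def)
    moreover have "inv_into (A i) (\<beta> i) e \<in> A i" "\<beta> i (inv_into (A i) (\<beta> i) e) = e"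
      using that(3) b by (auto simp: bij_betw_def inv_into_into f_inv_into_f)
    ultimately show ?thesis
      using that assms(1,2) points_update by (auto simp: \<psi>_def up_def)
  qed
  have hom: "(\<psi> c, \<psi> e) \<in> parcs ring" if ce: "(c, e) \<in> parcs (H i)" for c e
  proof -
    have "c \<in> A i \<and> e \<in> B i \<or> e \<in> A i \<and> c \<in> B i"
      using AB ce unfolding bipartition_def by blast
    then show ?thesis
      using up ce pair_graphD(3)[OF G ce] up_arc by blast
  qed
  have "(\<psi> (x i), \<psi> (\<beta> i a)) \<in> parcs ring ^^ m"
    using relpow_hom[OF hom m(2)] .
  moreover have "\<psi> (\<beta> i a) = (Suc i mod lam, x(i := a))"
    using \<open>\<beta> i a \<notin> A i\<close> b assms(3) by (simp add: \<psi>_def bij_betw_def)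
  ultimately show ?thesis
    using xi m(1) \<open>odd m\<close> by (auto simp: \<psi>_def)
qed

text \<open>The parity comes from concatenating \<open>lam\<close> odd walks. For
  \<open>x = y\<close> this yields a closed walk with the parity of \<open>lam\<close>.\<close>

lemma round_trip:
  assumes joined: "\<And>i a b. i < lam \<Longrightarrow> a \<in> A i \<Longrightarrow> b \<in> B i \<Longrightarrow> joined_within (H i) (\<tau> i) a b"
    and "x \<in> points" "y \<in> points"
  shows "\<exists>m\<le>\<Sum>i<lam. \<tau> i. (even m \<longleftrightarrow> even lam) \<and> ((0, x), (0, y)) \<in> parcs ring ^^ m"
proof -
  \<comment> \<open>\<open>?z k\<close> has already taken over the first \<open>k\<close>
    coordinates of \<open>y\<close>; as both points are extensional, \<open>?z lam\<close> is
    \<open>y\<close>.\<close>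
  let ?z = "\<lambda>k i. if i < k then y i else x i"
  have z: "?z k \<in> points" for k
    using assms(2,3) by (auto simp: points_def PiE_def extensional_def)
  have "\<exists>m\<le>\<Sum>i<k. \<tau> i. (even m \<longleftrightarrow> even k) \<and> ((0, x), (k mod lam, ?z k)) \<in> parcs ring ^^ m"
    if "k \<le> lam" for k
    using that
  proof (induction k)
    case (Suc k)
    then obtain m where m: "m \<le> (\<Sum>i<k. \<tau> i)" "even m \<longleftrightarrow> even k"
        "((0, x), (k, ?z k)) \<in> parcs ring ^^ m"
      by auto
    have k: "k < lam" using Suc.prems by simp
    have y: "y k \<in> A k" using points_A assms(3) k by blast
    then have "joined_within (H k) (\<tau> k) (?z k k) (\<beta> k (y k))"
      using joined[OF k points_A[OF z k]] bij_betwE[OF bij[OF k]] by blast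
    then obtain l where l: "l \<le> \<tau> k" "odd l"
        "((k, ?z k), (Suc k mod lam, (?z k)(k := y k))) \<in> parcs ring ^^ l"
      using layer_walk[OF k z y] by blast
    have "(?z k)(k := y k) = ?z (Suc k)" by (auto simp: fun_eq_iff less_Suc_eq)
    then have "((0, x), (Suc k mod lam, ?z (Suc k))) \<in> parcs ring ^^ (m + l)"
      using m(3) l(3) unfolding relpow_add by auto
    then show ?case using m(1,2) l(1,2) by (intro exI[of _ "m + l"]) auto
  qed auto
  from this[of lam] obtain m where "m \<le> (\<Sum>i<lam. \<tau> i)" "even m \<longleftrightarrow> even lam"
      "((0, x), (0, ?z lam)) \<in> parcs ring ^^ m"
    by auto
  moreover have "?z lam = y"
    using assms(2,3) by (auto simp: points_def PiE_def extensional_def fun_eq_iff)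
  ultimately show ?thesis by auto
qed

text \<open>For odd \<open>lam\<close> a round trip back to its start is an odd closed walk. For
  even \<open>lam\<close> the parity of the level is a bipartition, since reduction modulo
  \<open>lam\<close> preserves it.\<close>

lemma bipartite_ring:
  assumes joined: "\<And>i a b. i < lam \<Longrightarrow> a \<in> A i \<Longrightarrow> b \<in> B i \<Longrightarrow> joined_within (H i) (\<tau> i) a b"
    and "points \<noteq> {}"
  shows "bipartite ring \<longleftrightarrow> even lam"
proof
  assume "bipartite ring"
  then obtain P Q where PQ: "bipartition ring P Q" by (auto simp: bipartite_def)
  obtain x where x: "x \<in> points" using assms(2) by blast
  then have "(0, x) \<in> pverts ring" using lam by (simp add: ring_def)
  then show "even lam"
    using bipartition_walk[OF PQ, of "(0, x)" "(0, x)"] round_trip[of \<tau> x x] joined x by blast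
next
  assume "even lam"
  then have "even (Suc i mod lam) \<longleftrightarrow> odd i" for i
    by (metis dvd_mod_iff even_Suc)
  then have "even (fst u) \<longleftrightarrow> odd (fst v)" if "(u, v) \<in> parcs ring" for u v
    using that by (auto simp: ring_def up_def)
  then have "bipartition ring {u \<in> pverts ring. even (fst u)} {u \<in> pverts ring. odd (fst u)}"
    using pair_graphD(1,2)[OF pair_graph_ring] unfolding bipartition_def by fast
  then show "bipartite ring" by (auto simp: bipartite_def)
qed

lemma girth_ring:
  assumes "3 \<le> n" "n < 8" "n < lam" and f: "cyclic_seq ring n f"
  obtains i where "i < lam" "girth (H i) \<le> enat n"
proof -
  \<comment> \<open>The layer of a step is named after the level at which its conduit is read on the
    \<open>A\<close> side.\<close>
  define s where "s i = (if up (f i) (f (Suc i)) then fst (f i) else fst (f (Suc i)))" for i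
  have arc: "up (f i) (f (Suc i)) \<or> up (f (Suc i)) (f i)" for i
    using cyclic_seqD(3)[OF f, of i] by (simp add: ring_def)
  have s_less: "s i < lam" for i
    using arc[of i] by (auto simp: s_def up_def)
  have s_cases: "s i = fst (f i) \<and> fst (f (Suc i)) = Suc (s i) mod lam \<or>
      s i = fst (f (Suc i)) \<and> fst (f i) = Suc (s i) mod lam" for i
    using arc[of i] by (auto simp: s_def up_def)
  have coord: "snd (f (Suc i)) k = snd (f i) k" if "k \<noteq> s i" for i k
    using arc[of i] that by (auto simp: s_def up_def split: if_splits)
  have "s (i + n) = s i" for i
    using cyclic_seqD(2)[OF f, of i] cyclic_seqD(2)[OF f, of "Suc i"] by (simp add: s_def)
  then have "s (i mod n) = s i" for i by (rule periodic_mod)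
  then have s_range: "s i \<in> s ` {..<n}" for i
    using assms(1) by (metis imageI lessThan_iff mod_less_divisor not_numeral_le_zero gr0I)
  have "card (s ` {..<n}) < card {..<lam}"
    using card_image_le[of "{..<n}" s] assms(3) by simp
  then have "\<not> {..<lam} \<subseteq> s ` {..<n}"
    using card_mono[of "s ` {..<n}" "{..<lam}"] by auto
  then obtain m where "m < lam" "m \<notin> s ` {..<n}" by auto
  then have m: "m < lam" "s i \<noteq> m" for i
    using s_range by metis+
  text \<open>As layer \<open>m\<close> is not used, the levels can be cut open there.\<close>
  define ht where "ht l = (if l \<le> m then l + lam - Suc m else l - Suc m)" for l
  have ht_inj: "l = l'" if "ht l = ht l'" "l < lam" "l' < lam" for l l'
    using that m(1) by (auto simp: ht_def split: if_splits)
  \<comment> \<open>The level after \<open>m\<close> has height 0 and \<open>m\<close> has height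
    \<open>lam - 1\<close>, so only a step across layer \<open>m\<close> would violate this.\<close>
  have ht_Suc: "ht (Suc l mod lam) = Suc (ht l)" if "l < lam" "l \<noteq> m" for l
    using that m(1) by (auto simp: ht_def mod_Suc)
  define h where "h i = int (ht (fst (f i)))" for i
  have h_cases: "h i = int (ht (s i)) \<and> h (Suc i) = int (ht (s i)) + 1 \<or>
      h (Suc i) = int (ht (s i)) \<and> h i = int (ht (s i)) + 1" for i
    using s_cases[of i] ht_Suc[OF s_less m(2), of i] by (auto simp: h_def)
  have fst_less: "fst (f i) < lam" for i
    using arc[of i] lam by (auto simp: up_def)
  show thesis
  proof (cases "\<forall>i. s i = s 0")
    case False
    then obtain i0 where i0: "s i0 \<noteq> s 0" by blast
    have step: "\<bar>h (Suc i) - h i\<bar> = 1" for i using h_cases[of i] by auto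
    \<comment> \<open>The sum of the end heights determines the lower one and, by
      \<open>ht_inj\<close>, the layer.\<close>
    have sum: "h i + h (Suc i) = 2 * int (ht (s i)) + 1" for i
      using h_cases[of i] by auto
    have layer: "s i = s j \<longleftrightarrow> h i + h (Suc i) = h j + h (Suc j)" for i j
      unfolding sum using ht_inj[OF _ s_less s_less, of i j] by auto
    have per: "h (i + n) = h i" "snd (f (i + n)) = snd (f i)" for i
      using cyclic_seqD(2)[OF f, of i] by (simp_all add: h_def)
    obtain i j where ij: "i < n" "j < n" "i \<noteq> j" "h i = h j" "snd (f i) = snd (f j)"
      using short_multilayer_collapses[where X = "\<lambda>i. snd (f i)", OF assms(1,2) per step coord layer i0]
      by blast
    then have "f i = f j"
      using ht_inj[OF _ fst_less fst_less, of i j] by (simp add: h_def prod_eq_iff)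
    then show thesis
      using cyclic_seqD(1)[OF f] ij by (auto simp: inj_on_def)
  next
    case True
    \<comment> \<open>All steps lie in one layer \<open>l\<close>, so the sequence projects to a
      cycle of \<open>H l\<close>.\<close>
    define l where "l = s 0"
    have s_l: "s i = l" for i using True l_def by blast
    have l: "l < lam" using s_less l_def by blast
    note AB = parts[OF l] and b = bij[OF l]
    have const: "snd (f i) k = snd (f 0) k" if "k \<noteq> l" for i k
      by (induction i) (use coord s_l that in auto)
    have levels: "fst (f i) = l \<or> fst (f i) = Suc l mod lam" for i
      using s_cases[of i] s_l by auto
    have in_A: "snd (f i) l \<in> A l" for i
      using arc[of i] points_A[OF _ l] by (auto simp: up_def)
    define g where "g i = (if fst (f i) = l then snd (f i) l else \<beta> l (snd (f i) l))" for i
    have g_arc: "(g i, g (Suc i)) \<in> parcs (H l)" for i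
    proof (cases "up (f i) (f (Suc i))")
      case True
      then have "fst (f i) = l" using s_l[of i] by (simp add: s_def)
      then show ?thesis
        using True Suc_mod_lam_neq[OF l] by (simp add: up_def g_def)
    next
      case False
      then have "fst (f (Suc i)) = l" "up (f (Suc i)) (f i)"
        using s_l[of i] arc[of i] by (simp_all add: s_def)
      then have "(g (Suc i), g i) \<in> parcs (H l)"
        using Suc_mod_lam_neq[OF l] by (simp add: up_def g_def)
      then show ?thesis by (rule pair_graphD(3)[OF graph[OF l]])
    qed
    \<comment> \<open>The side of \<open>g i\<close> in \<open>H l\<close> reveals the level,
      injectivity of \<open>\<beta> l\<close> recovers coordinate \<open>l\<close>, and the other
      coordinates are constant.\<close>
    have g_inj: "f i = f j" if "g i = g j" for i j
    proof -
      have "\<beta> l (snd (f k) l) \<in> B l" for k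
        using bij_betwE[OF b] in_A by blast
      moreover have "A l \<inter> B l = {}" using AB by (simp add: bipartition_def)
      ultimately have eq: "(fst (f i) = l) = (fst (f j) = l)"
        using that in_A unfolding g_def by (metis disjoint_iff)
      then have "fst (f i) = fst (f j)" using levels[of i] levels[of j] by auto
      moreover have "snd (f i) l = snd (f j) l"
        using that eq bij_betw_imp_inj_on[OF b] in_A by (auto simp: g_def inj_on_eq_iff split: if_splits)
      then have "snd (f i) k = snd (f j) k" for k
        using const[of k i] const[of k j] by (cases "k = l") auto
      ultimately show ?thesis by (simp add: prod_eq_iff fun_eq_iff)
    qed
    have "inj_on g {..<n}"
      using inj_onD[OF cyclic_seqD(1)[OF f] g_inj] by (rule inj_onI)
    moreover have "g (i + n) = g i" for i
      using cyclic_seqD(2)[OF f, of i] by (simp add: g_def)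
    ultimately have "cyclic_seq (H l) n g"
      using g_arc by (simp add: cyclic_seq_def)
    then show thesis using girth_le[OF graph[OF l]] assms(1) l that by blast
  qed
qed

end

section \<open>Numerical estimates and assembly of the graph\<close>

lemma prod_scaled_power_le:
  fixes c :: "nat \<Rightarrow> real"
  assumes "\<And>i. i < lam \<Longrightarrow> 0 < c i \<and> c i * real \<Delta> ^ \<tau> i \<le> real (N i)"
  shows "(\<Prod>i<lam. c i) * real \<Delta> ^ (\<Sum>i<lam. \<tau> i) \<le> real (\<Prod>i<lam. N i)"
proof -
  have "(\<Prod>i<lam. c i) * real \<Delta> ^ (\<Sum>i<lam. \<tau> i) = (\<Prod>i<lam. c i * real \<Delta> ^ \<tau> i)"
    by (simp add: power_sum prod.distrib)
  also have "\<dots> \<le> (\<Prod>i<lam. real (N i))"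
    by (rule prod_mono) (use assms in \<open>force simp: less_imp_le\<close>)
  finally show ?thesis by simp
qed

lemma even_sum_odd:
  fixes \<tau> :: "nat \<Rightarrow> nat"
  assumes "\<And>i. i < n \<Longrightarrow> odd (\<tau> i)"
  shows "even (\<Sum>i<n. \<tau> i) \<longleftrightarrow> even n"
  using assms by (induction n) auto

lemma exists_inj_above:
  assumes "finite V"
  shows "\<exists>\<phi>. inj_on \<phi> V \<and> (\<forall>v\<in>V. (d::nat) < \<phi> v)"
proof -
  obtain \<phi> :: "_ \<Rightarrow> nat" where "inj_on \<phi> V"
    using finite_imp_inj_to_nat_seg[OF assms] by blast
  then show ?thesis
    by (intro exI[of _ "\<lambda>v. \<phi> v + Suc d"]) (auto simp: inj_on_def)
qed

theorem theorem6:
  fixes lam t d :: nat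
    and \<tau> :: "nat \<Rightarrow> nat" and \<gamma> :: "nat \<Rightarrow> enat" and c :: "nat \<Rightarrow> real"
  assumes "2 \<le> lam"
    and "\<And>i. i < lam \<Longrightarrow> 0 < \<tau> i \<and> odd (\<tau> i)"
    and "t = (\<Sum>i<lam. \<tau> i)"
    and "even d"
    and "\<And>i. i < lam \<Longrightarrow>
           \<exists>(H :: 'a pair_pre_digraph) A B. good_conduit H A B (\<tau> i) (d div 2) (\<gamma> i) (c i)"
  shows "\<exists>G :: nat pair_pre_digraph.
           pair_graph G \<and>
           max_degree G = d \<and>
           (\<Prod>i<lam. c i) * real d ^ t / 2 ^ t \<le> real (chromatic_number (graph_power G t)) \<and>
           Min {enat lam, 8, Min (\<gamma> ` {..<lam})} \<le> girth G \<and>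
           (bipartite G \<longleftrightarrow> even t)"
proof -
  obtain H :: "nat \<Rightarrow> 'a pair_pre_digraph" and A B where
    conduit: "\<And>i. i < lam \<Longrightarrow> good_conduit (H i) (A i) (B i) (\<tau> i) (d div 2) (\<gamma> i) (c i)"
    using assms(5) by metis
  have fin: "finite (A i)" "finite (B i)" if "i < lam" for i
  proof -
    interpret pair_graph "H i" using conduit[OF that] by (simp add: good_conduit_def)
    have "A i \<union> B i = pverts (H i)"
      using conduit[OF that] by (simp add: good_conduit_def bipartition_def)
    then show "finite (A i)" "finite (B i)"
      using pair_finite_verts by (metis finite_Un)+
  qed
  have "\<exists>b. i < lam \<longrightarrow> bij_betw b (A i) (B i)" for i
    using conduit[of i] fin[of i] by (auto simp: good_conduit_def intro: finite_same_card_bij)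
  then obtain \<beta> where "\<And>i. i < lam \<Longrightarrow> bij_betw (\<beta> i) (A i) (B i)"
    by metis
  then interpret conduit_ring lam H A B \<beta>
    using assms(1) conduit by (intro conduit_ring.intro) (simp_all add: good_conduit_def)
  have joined: "joined_within (H i) (\<tau> i) a b" if "i < lam" "a \<in> A i" "b \<in> B i" for i a b
    using conduit[OF that(1)] that(2,3) by (auto simp: good_conduit_def)
  have half: "2 * (d div 2) = d" using assms(4) by simp
  interpret ring: pair_graph ring by (rule pair_graph_ring)
  obtain \<phi> where \<phi>: "inj_on \<phi> (pverts ring)" "\<forall>v\<in>pverts ring. d < \<phi> v"
    using exists_inj_above[OF ring.pair_finite_verts] by blast
  have "card (parcs ring `` {v}) \<le> d" if "v \<in> pverts ring" for v
    using degree_ring[of "d div 2" v] conduit that half by (simp add: good_conduit_def)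
  then interpret star_completion d \<phi> ring
    using pair_graph_ring \<phi> by (intro star_completion.intro) auto
  have "(\<Prod>i<lam. c i) * real d ^ t / 2 ^ t = (\<Prod>i<lam. c i) * real (d div 2) ^ t"
    using half by (simp add: real_of_nat_div power_divide assms(4))
  also have "\<dots> \<le> real (card points)"
    unfolding assms(3) card_points
    by (rule prod_scaled_power_le) (use conduit in \<open>unfold good_conduit_def, blast\<close>)
  \<comment> \<open>The points are placed on level 0, the clique supplied by
    \<open>round_trip\<close>.\<close>
  also have "card points = card ({0::nat} \<times> points)"
    by (simp add: card_cartesian_product_singleton)
  also have "card ({0::nat} \<times> points) \<le> chromatic_number (graph_power G' t)"
  proof (rule chromatic_number_power_with_star)
    show "{0} \<times> points \<subseteq> pverts ring"
      using assms(1) by (auto simp: ring_def)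
    show "\<exists>m\<le>t. (u, v) \<in> parcs ring ^^ m" if "u \<in> {0} \<times> points" "v \<in> {0} \<times> points" for u v
      using that round_trip[of \<tau> "snd u" "snd v"] joined unfolding assms(3) by auto
  qed
  finally have chrom: "(\<Prod>i<lam. c i) * real d ^ t / 2 ^ t \<le> real (chromatic_number (graph_power G' t))"
    by simp
  have "Min {enat lam, 8, Min (\<gamma> ` {..<lam})} \<le> girth ring"
  proof (rule le_girthI)
    fix n f assume n: "3 \<le> n" and f: "cyclic_seq ring n f"
    show "Min {enat lam, 8, Min (\<gamma> ` {..<lam})} \<le> enat n"
    proof (cases "n < lam \<and> n < 8")
      case True
      then obtain i where i: "i < lam" "girth (H i) \<le> enat n"
        using girth_ring[OF n _ _ f] by blast
      then have "Min (\<gamma> ` {..<lam}) \<le> girth (H i)"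
        using conduit[OF i(1)] by (auto simp: good_conduit_def)
      then show ?thesis using i(2) by (auto simp: min_le_iff_disj)
    next
      case False
      \<comment> \<open>Sequences of length at least \<open>lam\<close> or 8 respect the bound
        trivially.\<close>
      then have "enat lam \<le> enat n \<or> 8 \<le> enat n"
        by (auto simp: numeral_eq_enat)
      then show ?thesis by (auto simp: min_le_iff_disj)
    qed
  qed
  then have girth: "Min {enat lam, 8, Min (\<gamma> ` {..<lam})} \<le> girth G'"
    using girth_with_star by (rule order_trans)
  \<comment> \<open>The parity argument needs a starting vertex; one exists as every
    \<open>A i\<close> is nonempty.\<close>
  have "points \<noteq> {}"
    unfolding points_def PiE_eq_empty_iff using conduit by (auto simp: good_conduit_def)
  then have "bipartite G' \<longleftrightarrow> even t"
    using bipartite_with_star bipartite_ring[of \<tau>] joined even_sum_odd[of lam \<tau>] assms(2,3) by simp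
  then show ?thesis
    using pair_graph_with_star max_degree_with_star chrom girth by blast
qed

end
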